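(* If $Q$ is a finite skew brace, then $M_b(Q)$ is finite. More precisely, every element of $M_b(Q)$ of order $n$ has a representative $(\alpha,\mu)\in Z^2_b(Q,\mathbb{C}^\times)$ such that $\mathrm{Im}(\alpha)\subseteq G_n$ and $\mathrm{Im}(\mu)\subseteq G_n$, where $G_n=\{z\in\mathbb{C}: z^n=1\}$.
   Context: A skew brace is a triple $(A,+,\circ)$ where $(A,+)$ and $(A,\circ)$ are (not necessarily abelian) groups with $a\circ(b+c)=a\circ b-a+a\circ c$ for all $a,b,c\in A$. Both groups have the same neutral element $0$. For a skew brace $Q$ and a (multiplicative) abelian group $K$, a factor set is a pair $(\alpha,\mu)$ of maps $Q\times Q\to K$ such that for all $x,y,z\in Q$: $\alpha(0,y)=\alpha(x,0)=1$, $\mu(0,y)=\mu(x,0)=1$, $\alpha(y,z)\alpha(x+y,z)^{-1}\alpha(x,y+z)\alpha(x,y)^{-1}=1$, $\mu(y,z)\mu(x\circ y,z)^{-1}\mu(x,y\circ z)\mu(x,y)^{-1}=1$, and $\alpha(y,z)\mu(x,y+z)\alpha(-x,x)=\mu(x,z)\alpha(x\circ y,-x)\alpha(x\circ y-x,x\circ z)\mu(x,y)$. Factor sets form a group $Z^2_b(Q,K)$ under pointwise multiplication. For $h:Q\to K$ put $\partial_+h(x,y)=h(y)h(x+y)^{-1}h(x)$ and $\partial_\circ h(x,y)=h(y)h(x\circ y)^{-1}h(x)$. Let $B^2_b(Q,K)=\{(\partial_+h,\partial_\circ h): h:Q\to K,\ h(0)=1\}$ and $H^2_b(Q,K)=Z^2_b(Q,K)/B^2_b(Q,K)$.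 The Schur multiplier of a finite skew brace $Q$ is $M_b(Q)=H^2_b(Q,\mathbb{C}^\times)$. *)

theory Defs
  imports Complex_Main "HOL-Algebra.Algebra"
begin

text \<open>
  A skew brace is carried by the signature of the \<open>ring\<close> record: the additive operation
  \<open>\<oplus>\<close> is the (not necessarily abelian) group operation \<open>+\<close>, and the multiplicative operation
  \<open>\<otimes>\<close> is the second group operation, usually written as a circle.
  That \<open>\<one>\<close> and \<open>\<zero>\<close> coincide is a consequence (\<open>skew_brace.one_eq_zero\<close>).
\<close>

locale skew_brace =
  fixes A :: "('a, 'b) ring_scheme" (structure)
  assumes add_group: "group (add_monoid A)"
    and circ_group: "group A"
    and brace: "\<lbrakk>a \<in> carrier A; b \<in> carrier A; c \<in> carrier A\<rbrakk>
      \<Longrightarrow> a \<otimes> (b \<oplus> c) = (a \<otimes> b) \<ominus> a \<oplus> (a \<otimes> c)"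

sublocale skew_brace \<subseteq> circ: group A
  by (rule circ_group)

sublocale skew_brace \<subseteq> add: group "add_monoid A"
  rewrites "carrier (add_monoid A) = carrier A"
    and "monoid.mult (add_monoid A) = add A"
    and "monoid.one (add_monoid A) = \<zero>\<^bsub>A\<^esub>"
    and "m_inv (add_monoid A) = a_inv A"
  by (rule add_group) (simp_all add: a_inv_def)

lemma (in skew_brace) a_minus_closed [simp]:
  "\<lbrakk>x \<in> carrier A; y \<in> carrier A\<rbrakk> \<Longrightarrow> x \<ominus> y \<in> carrier A"
  by (simp add: a_minus_def)

lemma (in skew_brace) one_eq_zero: "\<one> = \<zero>"
proof -
  have "\<one> \<otimes> (\<zero> \<oplus> \<zero>) = (\<one> \<otimes> \<zero>) \<ominus> \<one> \<oplus> (\<one> \<otimes> \<zero>)"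
    by (rule brace) simp_all
  then have "\<ominus> \<one> = \<zero>"
    by (simp add: a_minus_def)
  then have "\<ominus> (\<ominus> \<one>) = \<ominus> \<zero>"
    by simp
  then show ?thesis
    by simp
qed


text \<open>
  Maps from \<open>Q \<times> Q\<close> to \<open>K\<close> are represented as extensional functions on
  \<open>carrier Q \<times> carrier Q\<close>, so that equality of maps is equality of their values there.
\<close>

definition cochain_pairs ::
    "('a, 'b) ring_scheme \<Rightarrow> ('k, 'c) monoid_scheme \<Rightarrow> (('a \<times> 'a \<Rightarrow> 'k) \<times> ('a \<times> 'a \<Rightarrow> 'k)) monoid"
  where "cochain_pairs Q K =
    product_group (carrier Q \<times> carrier Q) (\<lambda>_. K) \<times>\<times> product_group (carrier Q \<times> carrier Q) (\<lambda>_. K)"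

definition factor_set ::
    "('a, 'b) ring_scheme \<Rightarrow> ('k, 'c) monoid_scheme \<Rightarrow> ('a \<times> 'a \<Rightarrow> 'k) \<Rightarrow> ('a \<times> 'a \<Rightarrow> 'k) \<Rightarrow> bool"
  where "factor_set Q K \<alpha> \<mu> \<longleftrightarrow>
    \<alpha> \<in> (carrier Q \<times> carrier Q) \<rightarrow>\<^sub>E carrier K \<and>
    \<mu> \<in> (carrier Q \<times> carrier Q) \<rightarrow>\<^sub>E carrier K \<and>
    (\<forall>x \<in> carrier Q. \<forall>y \<in> carrier Q. \<forall>z \<in> carrier Q.
      \<alpha> (\<zero>\<^bsub>Q\<^esub>, y) = \<one>\<^bsub>K\<^esub> \<and> \<alpha> (x, \<zero>\<^bsub>Q\<^esub>) = \<one>\<^bsub>K\<^esub> \<and>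
      \<mu> (\<zero>\<^bsub>Q\<^esub>, y) = \<one>\<^bsub>K\<^esub> \<and> \<mu> (x, \<zero>\<^bsub>Q\<^esub>) = \<one>\<^bsub>K\<^esub> \<and>
      \<alpha> (y, z) \<otimes>\<^bsub>K\<^esub> inv\<^bsub>K\<^esub> \<alpha> (x \<oplus>\<^bsub>Q\<^esub> y, z) \<otimes>\<^bsub>K\<^esub> \<alpha> (x, y \<oplus>\<^bsub>Q\<^esub> z) \<otimes>\<^bsub>K\<^esub> inv\<^bsub>K\<^esub> \<alpha> (x, y) = \<one>\<^bsub>K\<^esub> \<and>
      \<mu> (y, z) \<otimes>\<^bsub>K\<^esub> inv\<^bsub>K\<^esub> \<mu> (x \<otimes>\<^bsub>Q\<^esub> y, z) \<otimes>\<^bsub>K\<^esub> \<mu> (x, y \<otimes>\<^bsub>Q\<^esub> z) \<otimes>\<^bsub>K\<^esub> inv\<^bsub>K\<^esub> \<mu> (x, y) = \<one>\<^bsub>K\<^esub> \<and>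
      \<alpha> (y, z) \<otimes>\<^bsub>K\<^esub> \<mu> (x, y \<oplus>\<^bsub>Q\<^esub> z) \<otimes>\<^bsub>K\<^esub> \<alpha> (\<ominus>\<^bsub>Q\<^esub> x, x) =
        \<mu> (x, z) \<otimes>\<^bsub>K\<^esub> \<alpha> (x \<otimes>\<^bsub>Q\<^esub> y, \<ominus>\<^bsub>Q\<^esub> x) \<otimes>\<^bsub>K\<^esub>
          \<alpha> ((x \<otimes>\<^bsub>Q\<^esub> y) \<ominus>\<^bsub>Q\<^esub> x, x \<otimes>\<^bsub>Q\<^esub> z) \<otimes>\<^bsub>K\<^esub> \<mu> (x, y))"

definition Z2b ::
    "('a, 'b) ring_scheme \<Rightarrow> ('k, 'c) monoid_scheme \<Rightarrow> (('a \<times> 'a \<Rightarrow> 'k) \<times> ('a \<times> 'a \<Rightarrow> 'k)) monoid"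
  where "Z2b Q K = (cochain_pairs Q K)\<lparr>carrier := {(\<alpha>, \<mu>). factor_set Q K \<alpha> \<mu>}\<rparr>"

definition coboundary_add ::
    "('a, 'b) ring_scheme \<Rightarrow> ('k, 'c) monoid_scheme \<Rightarrow> ('a \<Rightarrow> 'k) \<Rightarrow> ('a \<times> 'a \<Rightarrow> 'k)"
  where "coboundary_add Q K h =
    (\<lambda>(x, y) \<in> carrier Q \<times> carrier Q. h y \<otimes>\<^bsub>K\<^esub> inv\<^bsub>K\<^esub> h (x \<oplus>\<^bsub>Q\<^esub> y) \<otimes>\<^bsub>K\<^esub> h x)"

definition coboundary_circ ::
    "('a, 'b) ring_scheme \<Rightarrow> ('k, 'c) monoid_scheme \<Rightarrow> ('a \<Rightarrow> 'k) \<Rightarrow> ('a \<times> 'a \<Rightarrow> 'k)"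
  where "coboundary_circ Q K h =
    (\<lambda>(x, y) \<in> carrier Q \<times> carrier Q. h y \<otimes>\<^bsub>K\<^esub> inv\<^bsub>K\<^esub> h (x \<otimes>\<^bsub>Q\<^esub> y) \<otimes>\<^bsub>K\<^esub> h x)"

definition B2b ::
    "('a, 'b) ring_scheme \<Rightarrow> ('k, 'c) monoid_scheme \<Rightarrow> (('a \<times> 'a \<Rightarrow> 'k) \<times> ('a \<times> 'a \<Rightarrow> 'k)) set"
  where "B2b Q K = {(coboundary_add Q K h, coboundary_circ Q K h) | h.
    h \<in> carrier Q \<rightarrow> carrier K \<and> h \<zero>\<^bsub>Q\<^esub> = \<one>\<^bsub>K\<^esub>}"

definition H2b ::
    "('a, 'b) ring_scheme \<Rightarrow> ('k, 'c) monoid_scheme \<Rightarrow> (('a \<times> 'a \<Rightarrow> 'k) \<times> ('a \<times> 'a \<Rightarrow> 'k)) set monoid"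
  where "H2b Q K = Z2b Q K Mod B2b Q K"

definition complex_units :: "complex monoid"
  where "complex_units = \<lparr>carrier = UNIV - {0}, monoid.mult = (*), one = 1\<rparr>"

definition schur_multiplier ::
    "('a, 'b) ring_scheme \<Rightarrow> (('a \<times> 'a \<Rightarrow> complex) \<times> ('a \<times> 'a \<Rightarrow> complex)) set monoid"
  where "schur_multiplier Q = H2b Q complex_units"


lemma comm_group_complex_units: "comm_group complex_units"
proof (rule comm_groupI)
  fix x assume "x \<in> carrier complex_units"
  then show "\<exists>y\<in>carrier complex_units. y \<otimes>\<^bsub>complex_units\<^esub> x = \<one>\<^bsub>complex_units\<^esub>"
    by (intro bexI[of _ "inverse x"]) (auto simp: complex_units_def)
qed (auto simp: complex_units_def)

lemma comm_group_cochain_pairs: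
  assumes "comm_group K"
  shows "comm_group (cochain_pairs Q K)"
proof -
  interpret K: comm_group K by fact
  have "group (cochain_pairs Q K)"
    unfolding cochain_pairs_def by (intro DirProd_group product_group K.is_group)
  then show ?thesis
    by (rule group.group_comm_groupI)
      (auto simp: cochain_pairs_def PiE_iff intro!: restrict_ext K.m_comm)
qed

lemma inv_cochain_pairs:
  assumes "comm_group K" "\<alpha> \<in> (carrier Q \<times> carrier Q) \<rightarrow>\<^sub>E carrier K"
    "\<mu> \<in> (carrier Q \<times> carrier Q) \<rightarrow>\<^sub>E carrier K"
  shows "inv\<^bsub>cochain_pairs Q K\<^esub> (\<alpha>, \<mu>) =
    (\<lambda>p\<in>carrier Q \<times> carrier Q. inv\<^bsub>K\<^esub> \<alpha> p, \<lambda>p\<in>carrier Q \<times> carrier Q. inv\<^bsub>K\<^esub> \<mu> p)"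
proof -
  interpret K: comm_group K by fact
  show ?thesis
    using assms by (simp add: cochain_pairs_def inv_DirProd K.is_group)
qed

lemma mult_cochain_pairs:
  "(\<alpha>, \<mu>) \<otimes>\<^bsub>cochain_pairs Q K\<^esub> (\<alpha>', \<mu>') =
    (\<lambda>p\<in>carrier Q \<times> carrier Q. \<alpha> p \<otimes>\<^bsub>K\<^esub> \<alpha>' p, \<lambda>p\<in>carrier Q \<times> carrier Q. \<mu> p \<otimes>\<^bsub>K\<^esub> \<mu>' p)"
  by (simp add: cochain_pairs_def)

lemma factor_set_zero:
  assumes "factor_set Q K \<alpha> \<mu>" "x \<in> carrier Q"
  shows "\<alpha> (\<zero>\<^bsub>Q\<^esub>, x) = \<one>\<^bsub>K\<^esub>" "\<alpha> (x, \<zero>\<^bsub>Q\<^esub>) = \<one>\<^bsub>K\<^esub>"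
    "\<mu> (\<zero>\<^bsub>Q\<^esub>, x) = \<one>\<^bsub>K\<^esub>" "\<mu> (x, \<zero>\<^bsub>Q\<^esub>) = \<one>\<^bsub>K\<^esub>"
  using assms unfolding factor_set_def by blast+

lemma factor_set_eqs:
  assumes "factor_set Q K \<alpha> \<mu>" "x \<in> carrier Q" "y \<in> carrier Q" "z \<in> carrier Q"
  shows "\<alpha> (y, z) \<otimes>\<^bsub>K\<^esub> inv\<^bsub>K\<^esub> \<alpha> (x \<oplus>\<^bsub>Q\<^esub> y, z) \<otimes>\<^bsub>K\<^esub> \<alpha> (x, y \<oplus>\<^bsub>Q\<^esub> z) \<otimes>\<^bsub>K\<^esub> inv\<^bsub>K\<^esub> \<alpha> (x, y) = \<one>\<^bsub>K\<^esub>"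
    "\<mu> (y, z) \<otimes>\<^bsub>K\<^esub> inv\<^bsub>K\<^esub> \<mu> (x \<otimes>\<^bsub>Q\<^esub> y, z) \<otimes>\<^bsub>K\<^esub> \<mu> (x, y \<otimes>\<^bsub>Q\<^esub> z) \<otimes>\<^bsub>K\<^esub> inv\<^bsub>K\<^esub> \<mu> (x, y) = \<one>\<^bsub>K\<^esub>"
    "\<alpha> (y, z) \<otimes>\<^bsub>K\<^esub> \<mu> (x, y \<oplus>\<^bsub>Q\<^esub> z) \<otimes>\<^bsub>K\<^esub> \<alpha> (\<ominus>\<^bsub>Q\<^esub> x, x) =
      \<mu> (x, z) \<otimes>\<^bsub>K\<^esub> \<alpha> (x \<otimes>\<^bsub>Q\<^esub> y, \<ominus>\<^bsub>Q\<^esub> x) \<otimes>\<^bsub>K\<^esub>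
        \<alpha> ((x \<otimes>\<^bsub>Q\<^esub> y) \<ominus>\<^bsub>Q\<^esub> x, x \<otimes>\<^bsub>Q\<^esub> z) \<otimes>\<^bsub>K\<^esub> \<mu> (x, y)"
  using assms unfolding factor_set_def by blast+

lemma subgroup_Z2b:
  assumes Q: "skew_brace Q" and K: "comm_group K"
  shows "subgroup {(\<alpha>, \<mu>). factor_set Q K \<alpha> \<mu>} (cochain_pairs Q K)"
proof -
  interpret Q: skew_brace Q by fact
  interpret K: comm_group K by fact
  interpret C: comm_group "cochain_pairs Q K" by (rule comm_group_cochain_pairs[OF K])
  show ?thesis
  proof (rule C.subgroupI)
    show "{(\<alpha>, \<mu>). factor_set Q K \<alpha> \<mu>} \<subseteq> carrier (cochain_pairs Q K)"
      by (auto simp: factor_set_def cochain_pairs_def)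
    have "factor_set Q K (\<lambda>p\<in>carrier Q \<times> carrier Q. \<one>\<^bsub>K\<^esub>) (\<lambda>p\<in>carrier Q \<times> carrier Q. \<one>\<^bsub>K\<^esub>)"
      by (auto simp: factor_set_def)
    then show "{(\<alpha>, \<mu>). factor_set Q K \<alpha> \<mu>} \<noteq> {}"
      by blast
  next
    fix a assume "a \<in> {(\<alpha>, \<mu>). factor_set Q K \<alpha> \<mu>}"
    then obtain \<alpha> \<mu> where a: "a = (\<alpha>, \<mu>)" and f: "factor_set Q K \<alpha> \<mu>" by auto
    have cl: "\<And>x y. \<lbrakk>x \<in> carrier Q; y \<in> carrier Q\<rbrakk> \<Longrightarrow> \<alpha> (x, y) \<in> carrier K"
      "\<And>x y. \<lbrakk>x \<in> carrier Q; y \<in> carrier Q\<rbrakk> \<Longrightarrow> \<mu> (x, y) \<in> carrier K"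
      using f by (auto simp: factor_set_def)
    note D = factor_set_zero[OF f] factor_set_eqs[OF f]
    have 1: "inv\<^bsub>K\<^esub> p \<otimes>\<^bsub>K\<^esub> q \<otimes>\<^bsub>K\<^esub> inv\<^bsub>K\<^esub> r \<otimes>\<^bsub>K\<^esub> s = \<one>\<^bsub>K\<^esub>"
      if "p \<otimes>\<^bsub>K\<^esub> inv\<^bsub>K\<^esub> q \<otimes>\<^bsub>K\<^esub> r \<otimes>\<^bsub>K\<^esub> inv\<^bsub>K\<^esub> s = \<one>\<^bsub>K\<^esub>"
        "p \<in> carrier K" "q \<in> carrier K" "r \<in> carrier K" "s \<in> carrier K" for p q r s
    proof -
      have "inv\<^bsub>K\<^esub> p \<otimes>\<^bsub>K\<^esub> q \<otimes>\<^bsub>K\<^esub> inv\<^bsub>K\<^esub> r \<otimes>\<^bsub>K\<^esub> s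
          = inv\<^bsub>K\<^esub> (p \<otimes>\<^bsub>K\<^esub> inv\<^bsub>K\<^esub> q \<otimes>\<^bsub>K\<^esub> r \<otimes>\<^bsub>K\<^esub> inv\<^bsub>K\<^esub> s)"
        using that(2-) by (simp add: K.inv_mult)
      also have "\<dots> = inv\<^bsub>K\<^esub> \<one>\<^bsub>K\<^esub>"
        by (simp only: that(1))
      finally show ?thesis by simp
    qed
    have 2: "inv\<^bsub>K\<^esub> p \<otimes>\<^bsub>K\<^esub> inv\<^bsub>K\<^esub> q \<otimes>\<^bsub>K\<^esub> inv\<^bsub>K\<^esub> r = inv\<^bsub>K\<^esub> s \<otimes>\<^bsub>K\<^esub> inv\<^bsub>K\<^esub> t \<otimes>\<^bsub>K\<^esub> inv\<^bsub>K\<^esub> u \<otimes>\<^bsub>K\<^esub> inv\<^bsub>K\<^esub> v"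
      if e: "p \<otimes>\<^bsub>K\<^esub> q \<otimes>\<^bsub>K\<^esub> r = s \<otimes>\<^bsub>K\<^esub> t \<otimes>\<^bsub>K\<^esub> u \<otimes>\<^bsub>K\<^esub> v"
        and c: "p \<in> carrier K" "q \<in> carrier K" "r \<in> carrier K" "s \<in> carrier K"
        "t \<in> carrier K" "u \<in> carrier K" "v \<in> carrier K" for p q r s t u v
    proof -
      have "inv\<^bsub>K\<^esub> (p \<otimes>\<^bsub>K\<^esub> q \<otimes>\<^bsub>K\<^esub> r) = inv\<^bsub>K\<^esub> (s \<otimes>\<^bsub>K\<^esub> t \<otimes>\<^bsub>K\<^esub> u \<otimes>\<^bsub>K\<^esub> v)"
        by (simp only: e)
      then show ?thesis using c by (simp add: K.inv_mult)
    qed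
    have "factor_set Q K (\<lambda>p\<in>carrier Q \<times> carrier Q. inv\<^bsub>K\<^esub> \<alpha> p) (\<lambda>p\<in>carrier Q \<times> carrier Q. inv\<^bsub>K\<^esub> \<mu> p)"
      unfolding factor_set_def
      by (intro conjI ballI; (simp add: cl D)?; (intro 1 2; simp add: cl D)?; (auto simp: cl)?)
    then show "inv\<^bsub>cochain_pairs Q K\<^esub> a \<in> {(\<alpha>, \<mu>). factor_set Q K \<alpha> \<mu>}"
      using f inv_cochain_pairs[OF K, of \<alpha> Q \<mu>] by (simp add: a factor_set_def)
  next
    fix a b assume "a \<in> {(\<alpha>, \<mu>). factor_set Q K \<alpha> \<mu>}" "b \<in> {(\<alpha>, \<mu>). factor_set Q K \<alpha> \<mu>}"
    then obtain \<alpha> \<mu> \<alpha>' \<mu>' where a: "a = (\<alpha>, \<mu>)" and f: "factor_set Q K \<alpha> \<mu>"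
      and b: "b = (\<alpha>', \<mu>')" and f': "factor_set Q K \<alpha>' \<mu>'" by auto
    have cl: "\<And>x y. \<lbrakk>x \<in> carrier Q; y \<in> carrier Q\<rbrakk> \<Longrightarrow> \<alpha> (x, y) \<in> carrier K"
      "\<And>x y. \<lbrakk>x \<in> carrier Q; y \<in> carrier Q\<rbrakk> \<Longrightarrow> \<mu> (x, y) \<in> carrier K"
      "\<And>x y. \<lbrakk>x \<in> carrier Q; y \<in> carrier Q\<rbrakk> \<Longrightarrow> \<alpha>' (x, y) \<in> carrier K"
      "\<And>x y. \<lbrakk>x \<in> carrier Q; y \<in> carrier Q\<rbrakk> \<Longrightarrow> \<mu>' (x, y) \<in> carrier K"
      using f f' by (auto simp: factor_set_def)
    note D = factor_set_zero[OF f] factor_set_eqs[OF f] factor_set_zero[OF f'] factor_set_eqs[OF f']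
    have 1: "(p \<otimes>\<^bsub>K\<^esub> p') \<otimes>\<^bsub>K\<^esub> inv\<^bsub>K\<^esub> (q \<otimes>\<^bsub>K\<^esub> q') \<otimes>\<^bsub>K\<^esub> (r \<otimes>\<^bsub>K\<^esub> r') \<otimes>\<^bsub>K\<^esub> inv\<^bsub>K\<^esub> (s \<otimes>\<^bsub>K\<^esub> s') = \<one>\<^bsub>K\<^esub>"
      if e: "p \<otimes>\<^bsub>K\<^esub> inv\<^bsub>K\<^esub> q \<otimes>\<^bsub>K\<^esub> r \<otimes>\<^bsub>K\<^esub> inv\<^bsub>K\<^esub> s = \<one>\<^bsub>K\<^esub>"
        "p' \<otimes>\<^bsub>K\<^esub> inv\<^bsub>K\<^esub> q' \<otimes>\<^bsub>K\<^esub> r' \<otimes>\<^bsub>K\<^esub> inv\<^bsub>K\<^esub> s' = \<one>\<^bsub>K\<^esub>"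
        and c: "p \<in> carrier K" "q \<in> carrier K" "r \<in> carrier K" "s \<in> carrier K"
        "p' \<in> carrier K" "q' \<in> carrier K" "r' \<in> carrier K" "s' \<in> carrier K"
      for p q r s p' q' r' s'
    proof -
      have "(p \<otimes>\<^bsub>K\<^esub> p') \<otimes>\<^bsub>K\<^esub> inv\<^bsub>K\<^esub> (q \<otimes>\<^bsub>K\<^esub> q') \<otimes>\<^bsub>K\<^esub> (r \<otimes>\<^bsub>K\<^esub> r') \<otimes>\<^bsub>K\<^esub> inv\<^bsub>K\<^esub> (s \<otimes>\<^bsub>K\<^esub> s') =
          (p \<otimes>\<^bsub>K\<^esub> inv\<^bsub>K\<^esub> q \<otimes>\<^bsub>K\<^esub> r \<otimes>\<^bsub>K\<^esub> inv\<^bsub>K\<^esub> s) \<otimes>\<^bsub>K\<^esub> (p' \<otimes>\<^bsub>K\<^esub> inv\<^bsub>K\<^esub> q' \<otimes>\<^bsub>K\<^esub> r' \<otimes>\<^bsub>K\<^esub> inv\<^bsub>K\<^esub> s')"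
        using c by (simp add: K.inv_mult K.m_ac)
      then show ?thesis by (simp only: e) simp
    qed
    have 2: "(p \<otimes>\<^bsub>K\<^esub> p') \<otimes>\<^bsub>K\<^esub> (q \<otimes>\<^bsub>K\<^esub> q') \<otimes>\<^bsub>K\<^esub> (r \<otimes>\<^bsub>K\<^esub> r') =
        (s \<otimes>\<^bsub>K\<^esub> s') \<otimes>\<^bsub>K\<^esub> (t \<otimes>\<^bsub>K\<^esub> t') \<otimes>\<^bsub>K\<^esub> (u \<otimes>\<^bsub>K\<^esub> u') \<otimes>\<^bsub>K\<^esub> (v \<otimes>\<^bsub>K\<^esub> v')"
      if e: "p \<otimes>\<^bsub>K\<^esub> q \<otimes>\<^bsub>K\<^esub> r = s \<otimes>\<^bsub>K\<^esub> t \<otimes>\<^bsub>K\<^esub> u \<otimes>\<^bsub>K\<^esub> v"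
        "p' \<otimes>\<^bsub>K\<^esub> q' \<otimes>\<^bsub>K\<^esub> r' = s' \<otimes>\<^bsub>K\<^esub> t' \<otimes>\<^bsub>K\<^esub> u' \<otimes>\<^bsub>K\<^esub> v'"
        and c: "p \<in> carrier K" "q \<in> carrier K" "r \<in> carrier K" "s \<in> carrier K"
        "t \<in> carrier K" "u \<in> carrier K" "v \<in> carrier K"
        "p' \<in> carrier K" "q' \<in> carrier K" "r' \<in> carrier K" "s' \<in> carrier K"
        "t' \<in> carrier K" "u' \<in> carrier K" "v' \<in> carrier K"
      for p q r s t u v p' q' r' s' t' u' v'
    proof -
      have "(p \<otimes>\<^bsub>K\<^esub> p') \<otimes>\<^bsub>K\<^esub> (q \<otimes>\<^bsub>K\<^esub> q') \<otimes>\<^bsub>K\<^esub> (r \<otimes>\<^bsub>K\<^esub> r') =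
          (p \<otimes>\<^bsub>K\<^esub> q \<otimes>\<^bsub>K\<^esub> r) \<otimes>\<^bsub>K\<^esub> (p' \<otimes>\<^bsub>K\<^esub> q' \<otimes>\<^bsub>K\<^esub> r')"
        using c by (simp add: K.m_ac)
      also have "\<dots> = (s \<otimes>\<^bsub>K\<^esub> t \<otimes>\<^bsub>K\<^esub> u \<otimes>\<^bsub>K\<^esub> v) \<otimes>\<^bsub>K\<^esub> (s' \<otimes>\<^bsub>K\<^esub> t' \<otimes>\<^bsub>K\<^esub> u' \<otimes>\<^bsub>K\<^esub> v')"
        by (simp only: e)
      also have "\<dots> = (s \<otimes>\<^bsub>K\<^esub> s') \<otimes>\<^bsub>K\<^esub> (t \<otimes>\<^bsub>K\<^esub> t') \<otimes>\<^bsub>K\<^esub> (u \<otimes>\<^bsub>K\<^esub> u') \<otimes>\<^bsub>K\<^esub> (v \<otimes>\<^bsub>K\<^esub> v')"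
        using c by (simp add: K.m_ac)
      finally show ?thesis .
    qed
    have "factor_set Q K (\<lambda>p\<in>carrier Q \<times> carrier Q. \<alpha> p \<otimes>\<^bsub>K\<^esub> \<alpha>' p)
        (\<lambda>p\<in>carrier Q \<times> carrier Q. \<mu> p \<otimes>\<^bsub>K\<^esub> \<mu>' p)"
      unfolding factor_set_def
      by (intro conjI ballI; (simp add: cl D)?; (intro 1 2; simp add: cl D)?; (auto simp: cl)?)
    then show "a \<otimes>\<^bsub>cochain_pairs Q K\<^esub> b \<in> {(\<alpha>, \<mu>). factor_set Q K \<alpha> \<mu>}"
      by (simp add: a b mult_cochain_pairs)
  qed
qed

lemma comm_group_Z2b:
  assumes "skew_brace Q" "comm_group K"
  shows "comm_group (Z2b Q K)"
proof -
  interpret C: comm_group "cochain_pairs Q K" by (rule comm_group_cochain_pairs[OF assms(2)])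
  have "group (Z2b Q K)"
    unfolding Z2b_def by (rule C.subgroup_imp_group[OF subgroup_Z2b[OF assms]])
  then show ?thesis
    using subgroup.subset[OF subgroup_Z2b[OF assms]]
    by (intro group.group_comm_groupI) (auto simp: Z2b_def intro!: C.m_comm)
qed

lemma subgroup_B2b:
  assumes Q: "skew_brace Q" and K: "comm_group K"
  shows "subgroup (B2b Q K) (Z2b Q K)"
proof -
  interpret Q: skew_brace Q by fact
  interpret K: comm_group K by fact
  interpret C: comm_group "cochain_pairs Q K" by (rule comm_group_cochain_pairs[OF K])
  interpret Z: comm_group "Z2b Q K" by (rule comm_group_Z2b[OF Q K])
  have cob: "\<And>h x y. \<lbrakk>x \<in> carrier Q; y \<in> carrier Q\<rbrakk> \<Longrightarrow>
      coboundary_add Q K h (x, y) = h y \<otimes>\<^bsub>K\<^esub> inv\<^bsub>K\<^esub> h (x \<oplus>\<^bsub>Q\<^esub> y) \<otimes>\<^bsub>K\<^esub> h x"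
    "\<And>h x y. \<lbrakk>x \<in> carrier Q; y \<in> carrier Q\<rbrakk> \<Longrightarrow>
      coboundary_circ Q K h (x, y) = h y \<otimes>\<^bsub>K\<^esub> inv\<^bsub>K\<^esub> h (x \<otimes>\<^bsub>Q\<^esub> y) \<otimes>\<^bsub>K\<^esub> h x"
    by (auto simp: coboundary_add_def coboundary_circ_def)
  have cocycle: "(b \<otimes>\<^bsub>K\<^esub> inv\<^bsub>K\<^esub> c \<otimes>\<^bsub>K\<^esub> a) \<otimes>\<^bsub>K\<^esub> inv\<^bsub>K\<^esub> (b \<otimes>\<^bsub>K\<^esub> inv\<^bsub>K\<^esub> e \<otimes>\<^bsub>K\<^esub> f) \<otimes>\<^bsub>K\<^esub>
      (c \<otimes>\<^bsub>K\<^esub> inv\<^bsub>K\<^esub> e \<otimes>\<^bsub>K\<^esub> d) \<otimes>\<^bsub>K\<^esub> inv\<^bsub>K\<^esub> (a \<otimes>\<^bsub>K\<^esub> inv\<^bsub>K\<^esub> f \<otimes>\<^bsub>K\<^esub> d) = \<one>\<^bsub>K\<^esub>" (is "?l = _")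
    if c: "a \<in> carrier K" "b \<in> carrier K" "c \<in> carrier K" "d \<in> carrier K" "e \<in> carrier K" "f \<in> carrier K"
    for a b c d e f
  proof -
    have "?l = (a \<otimes>\<^bsub>K\<^esub> inv\<^bsub>K\<^esub> a) \<otimes>\<^bsub>K\<^esub> (b \<otimes>\<^bsub>K\<^esub> inv\<^bsub>K\<^esub> b) \<otimes>\<^bsub>K\<^esub> (c \<otimes>\<^bsub>K\<^esub> inv\<^bsub>K\<^esub> c) \<otimes>\<^bsub>K\<^esub> (d \<otimes>\<^bsub>K\<^esub> inv\<^bsub>K\<^esub> d)
        \<otimes>\<^bsub>K\<^esub> (e \<otimes>\<^bsub>K\<^esub> inv\<^bsub>K\<^esub> e) \<otimes>\<^bsub>K\<^esub> (f \<otimes>\<^bsub>K\<^esub> inv\<^bsub>K\<^esub> f)"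
      using c by (simp add: K.inv_mult K.m_ac del: K.r_inv K.l_inv K.Units_r_inv K.Units_l_inv)
    then show ?thesis using c by simp
  qed
  have compat: "(b \<otimes>\<^bsub>K\<^esub> inv\<^bsub>K\<^esub> c \<otimes>\<^bsub>K\<^esub> a) \<otimes>\<^bsub>K\<^esub> (c \<otimes>\<^bsub>K\<^esub> inv\<^bsub>K\<^esub> g \<otimes>\<^bsub>K\<^esub> d) \<otimes>\<^bsub>K\<^esub> (d \<otimes>\<^bsub>K\<^esub> m) =
      (b \<otimes>\<^bsub>K\<^esub> inv\<^bsub>K\<^esub> k \<otimes>\<^bsub>K\<^esub> d) \<otimes>\<^bsub>K\<^esub> (m \<otimes>\<^bsub>K\<^esub> inv\<^bsub>K\<^esub> w \<otimes>\<^bsub>K\<^esub> l) \<otimes>\<^bsub>K\<^esub> (k \<otimes>\<^bsub>K\<^esub> inv\<^bsub>K\<^esub> g \<otimes>\<^bsub>K\<^esub> w) \<otimes>\<^bsub>K\<^esub>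
        (a \<otimes>\<^bsub>K\<^esub> inv\<^bsub>K\<^esub> l \<otimes>\<^bsub>K\<^esub> d)" (is "?l = ?r")
    if c: "a \<in> carrier K" "b \<in> carrier K" "c \<in> carrier K" "d \<in> carrier K" "g \<in> carrier K"
      "k \<in> carrier K" "l \<in> carrier K" "m \<in> carrier K" "w \<in> carrier K"
    for a b c d g k l m w
  proof -
    let ?p = "a \<otimes>\<^bsub>K\<^esub> b \<otimes>\<^bsub>K\<^esub> d \<otimes>\<^bsub>K\<^esub> d \<otimes>\<^bsub>K\<^esub> m \<otimes>\<^bsub>K\<^esub> inv\<^bsub>K\<^esub> g"
    have "?l = ?p \<otimes>\<^bsub>K\<^esub> (c \<otimes>\<^bsub>K\<^esub> inv\<^bsub>K\<^esub> c)"
      using c by (simp add: K.m_ac del: K.r_inv K.l_inv K.Units_r_inv K.Units_l_inv)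
    moreover have "?r = ?p \<otimes>\<^bsub>K\<^esub> (k \<otimes>\<^bsub>K\<^esub> inv\<^bsub>K\<^esub> k) \<otimes>\<^bsub>K\<^esub> (l \<otimes>\<^bsub>K\<^esub> inv\<^bsub>K\<^esub> l) \<otimes>\<^bsub>K\<^esub> (w \<otimes>\<^bsub>K\<^esub> inv\<^bsub>K\<^esub> w)"
      using c by (simp add: K.m_ac del: K.r_inv K.l_inv K.Units_r_inv K.Units_l_inv)
    ultimately show ?thesis using c by simp
  qed
  have sub: "B2b Q K \<subseteq> {(\<alpha>, \<mu>). factor_set Q K \<alpha> \<mu>}"
  proof
    fix p assume "p \<in> B2b Q K"
    then obtain h where p: "p = (coboundary_add Q K h, coboundary_circ Q K h)"
      and h: "h \<in> carrier Q \<rightarrow> carrier K" and h0: "h \<zero>\<^bsub>Q\<^esub> = \<one>\<^bsub>K\<^esub>"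
      by (auto simp: B2b_def)
    have hc: "\<And>x. x \<in> carrier Q \<Longrightarrow> h x \<in> carrier K" using h by auto
    have add0: "\<And>x. x \<in> carrier Q \<Longrightarrow> x \<otimes>\<^bsub>Q\<^esub> \<zero>\<^bsub>Q\<^esub> = x" "\<And>x. x \<in> carrier Q \<Longrightarrow> \<zero>\<^bsub>Q\<^esub> \<otimes>\<^bsub>Q\<^esub> x = x"
      by (simp_all flip: Q.one_eq_zero)
    have "factor_set Q K (coboundary_add Q K h) (coboundary_circ Q K h)"
      unfolding factor_set_def
    proof (intro conjI ballI)
      show "coboundary_add Q K h \<in> (carrier Q \<times> carrier Q) \<rightarrow>\<^sub>E carrier K"
        "coboundary_circ Q K h \<in> (carrier Q \<times> carrier Q) \<rightarrow>\<^sub>E carrier K"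
        by (auto simp: coboundary_add_def coboundary_circ_def hc)
    next
      fix x y z assume [simp]: "x \<in> carrier Q" "y \<in> carrier Q" "z \<in> carrier Q"
      show "coboundary_add Q K h (\<zero>\<^bsub>Q\<^esub>, y) = \<one>\<^bsub>K\<^esub>" "coboundary_add Q K h (x, \<zero>\<^bsub>Q\<^esub>) = \<one>\<^bsub>K\<^esub>"
        "coboundary_circ Q K h (\<zero>\<^bsub>Q\<^esub>, y) = \<one>\<^bsub>K\<^esub>" "coboundary_circ Q K h (x, \<zero>\<^bsub>Q\<^esub>) = \<one>\<^bsub>K\<^esub>"
        by (simp_all add: cob hc h0 add0)
      show "coboundary_add Q K h (y, z) \<otimes>\<^bsub>K\<^esub> inv\<^bsub>K\<^esub> coboundary_add Q K h (x \<oplus>\<^bsub>Q\<^esub> y, z) \<otimes>\<^bsub>K\<^esub>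
          coboundary_add Q K h (x, y \<oplus>\<^bsub>Q\<^esub> z) \<otimes>\<^bsub>K\<^esub> inv\<^bsub>K\<^esub> coboundary_add Q K h (x, y) = \<one>\<^bsub>K\<^esub>"
        by (simp add: cob Q.add.m_assoc cocycle hc)
      show "coboundary_circ Q K h (y, z) \<otimes>\<^bsub>K\<^esub> inv\<^bsub>K\<^esub> coboundary_circ Q K h (x \<otimes>\<^bsub>Q\<^esub> y, z) \<otimes>\<^bsub>K\<^esub>
          coboundary_circ Q K h (x, y \<otimes>\<^bsub>Q\<^esub> z) \<otimes>\<^bsub>K\<^esub> inv\<^bsub>K\<^esub> coboundary_circ Q K h (x, y) = \<one>\<^bsub>K\<^esub>"
        by (simp add: cob Q.circ.m_assoc cocycle hc)
      have "coboundary_add Q K h (\<ominus>\<^bsub>Q\<^esub> x, x) = h x \<otimes>\<^bsub>K\<^esub> h (\<ominus>\<^bsub>Q\<^esub> x)"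
        by (simp add: cob h0 hc)
      moreover have "coboundary_add Q K h (x \<otimes>\<^bsub>Q\<^esub> y, \<ominus>\<^bsub>Q\<^esub> x) =
          h (\<ominus>\<^bsub>Q\<^esub> x) \<otimes>\<^bsub>K\<^esub> inv\<^bsub>K\<^esub> h ((x \<otimes>\<^bsub>Q\<^esub> y) \<ominus>\<^bsub>Q\<^esub> x) \<otimes>\<^bsub>K\<^esub> h (x \<otimes>\<^bsub>Q\<^esub> y)"
        by (simp add: cob a_minus_def)
      moreover have "coboundary_add Q K h ((x \<otimes>\<^bsub>Q\<^esub> y) \<ominus>\<^bsub>Q\<^esub> x, x \<otimes>\<^bsub>Q\<^esub> z) =
          h (x \<otimes>\<^bsub>Q\<^esub> z) \<otimes>\<^bsub>K\<^esub> inv\<^bsub>K\<^esub> h (x \<otimes>\<^bsub>Q\<^esub> (y \<oplus>\<^bsub>Q\<^esub> z)) \<otimes>\<^bsub>K\<^esub> h ((x \<otimes>\<^bsub>Q\<^esub> y) \<ominus>\<^bsub>Q\<^esub> x)"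
        by (simp add: cob Q.brace)
      ultimately show "coboundary_add Q K h (y, z) \<otimes>\<^bsub>K\<^esub> coboundary_circ Q K h (x, y \<oplus>\<^bsub>Q\<^esub> z) \<otimes>\<^bsub>K\<^esub>
            coboundary_add Q K h (\<ominus>\<^bsub>Q\<^esub> x, x) =
          coboundary_circ Q K h (x, z) \<otimes>\<^bsub>K\<^esub> coboundary_add Q K h (x \<otimes>\<^bsub>Q\<^esub> y, \<ominus>\<^bsub>Q\<^esub> x) \<otimes>\<^bsub>K\<^esub>
            coboundary_add Q K h ((x \<otimes>\<^bsub>Q\<^esub> y) \<ominus>\<^bsub>Q\<^esub> x, x \<otimes>\<^bsub>Q\<^esub> z) \<otimes>\<^bsub>K\<^esub> coboundary_circ Q K h (x, y)"
        by (simp only:) (simp add: cob compat hc)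
    qed
    then show "p \<in> {(\<alpha>, \<mu>). factor_set Q K \<alpha> \<mu>}" by (simp add: p)
  qed
  have "subgroup (B2b Q K) (cochain_pairs Q K)"
  proof (rule C.subgroupI)
    show "B2b Q K \<subseteq> carrier (cochain_pairs Q K)"
      using sub subgroup.subset[OF subgroup_Z2b[OF Q K]] by blast
    have "(coboundary_add Q K (\<lambda>_. \<one>\<^bsub>K\<^esub>), coboundary_circ Q K (\<lambda>_. \<one>\<^bsub>K\<^esub>)) \<in> B2b Q K"
      unfolding B2b_def by force
    then show "B2b Q K \<noteq> {}" by blast
  next
    fix a assume aB: "a \<in> B2b Q K"
    then obtain h where a: "a = (coboundary_add Q K h, coboundary_circ Q K h)"
      and h: "h \<in> carrier Q \<rightarrow> carrier K" and h0: "h \<zero>\<^bsub>Q\<^esub> = \<one>\<^bsub>K\<^esub>"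
      by (auto simp: B2b_def)
    have hc: "\<And>x. x \<in> carrier Q \<Longrightarrow> h x \<in> carrier K" using h by auto
    have fa: "factor_set Q K (coboundary_add Q K h) (coboundary_circ Q K h)"
      using aB sub by (auto simp: a)
    have "inv\<^bsub>cochain_pairs Q K\<^esub> a =
        (\<lambda>p\<in>carrier Q \<times> carrier Q. inv\<^bsub>K\<^esub> coboundary_add Q K h p,
         \<lambda>p\<in>carrier Q \<times> carrier Q. inv\<^bsub>K\<^esub> coboundary_circ Q K h p)"
      unfolding a using fa by (intro inv_cochain_pairs K) (simp_all add: factor_set_def)
    also have "\<dots> = (coboundary_add Q K (\<lambda>x. inv\<^bsub>K\<^esub> h x), coboundary_circ Q K (\<lambda>x. inv\<^bsub>K\<^esub> h x))"
      by (auto simp: coboundary_add_def coboundary_circ_def hc K.inv_mult intro!: restrict_ext)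
    also have "\<dots> \<in> B2b Q K"
      unfolding B2b_def using h h0 by (intro CollectI exI[of _ "\<lambda>x. inv\<^bsub>K\<^esub> h x"]) auto
    finally show "inv\<^bsub>cochain_pairs Q K\<^esub> a \<in> B2b Q K" .
  next
    fix a b assume "a \<in> B2b Q K" "b \<in> B2b Q K"
    then obtain h h' where a: "a = (coboundary_add Q K h, coboundary_circ Q K h)"
      and h: "h \<in> carrier Q \<rightarrow> carrier K" and h0: "h \<zero>\<^bsub>Q\<^esub> = \<one>\<^bsub>K\<^esub>"
      and b: "b = (coboundary_add Q K h', coboundary_circ Q K h')"
      and h': "h' \<in> carrier Q \<rightarrow> carrier K" and h0': "h' \<zero>\<^bsub>Q\<^esub> = \<one>\<^bsub>K\<^esub>"
      by (auto simp: B2b_def)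
    have hc: "\<And>x. x \<in> carrier Q \<Longrightarrow> h x \<in> carrier K" "\<And>x. x \<in> carrier Q \<Longrightarrow> h' x \<in> carrier K"
      using h h' by auto
    have "a \<otimes>\<^bsub>cochain_pairs Q K\<^esub> b =
        (coboundary_add Q K (\<lambda>x. h x \<otimes>\<^bsub>K\<^esub> h' x), coboundary_circ Q K (\<lambda>x. h x \<otimes>\<^bsub>K\<^esub> h' x))"
      by (auto simp: a b mult_cochain_pairs coboundary_add_def coboundary_circ_def hc K.inv_mult K.m_ac
          intro!: restrict_ext)
    also have "\<dots> \<in> B2b Q K"
      unfolding B2b_def using h h' h0 h0'
      by (intro CollectI exI[of _ "\<lambda>x. h x \<otimes>\<^bsub>K\<^esub> h' x"]) auto
    finally show "a \<otimes>\<^bsub>cochain_pairs Q K\<^esub> b \<in> B2b Q K" .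
  qed
  then show ?thesis
    unfolding Z2b_def by (rule C.subgroup_incl[OF _ subgroup_Z2b[OF Q K] sub])
qed

lemma comm_group_H2b:
  assumes "skew_brace Q" "comm_group K"
  shows "comm_group (H2b Q K)"
  unfolding H2b_def
  by (rule comm_group.abelian_FactGroup[OF comm_group_Z2b subgroup_B2b]) (rule assms)+

lemma comm_group_schur_multiplier: "skew_brace Q \<Longrightarrow> comm_group (schur_multiplier Q)"
  unfolding schur_multiplier_def by (rule comm_group_H2b[OF _ comm_group_complex_units])

end

theory Submission
  imports Defs
begin

text \<open>
  Let \<open>N\<close> be the order of \<open>Q\<close>. Multiplying the cocycle identity for \<open>\<alpha>\<close> over its last argument
  shows \<open>\<alpha>\<^sup>N = \<partial>\<^sub>+ h\<close> with \<open>h x = \<Prod>\<^sub>z \<alpha> (x, z)\<close>, so up to a coboundary the \<open>N\<close>-th power of a factor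
  set has the form \<open>(1, \<mu>)\<close>. The compatibility condition then says that every \<open>\<mu> (x, _)\<close> is a
  homomorphism on the additive group, whence \<open>\<mu>\<^sup>N = 1\<close>, and \<open>N\<^sup>2\<close> annihilates the cohomology group.
  Since \<open>\<complex>\<^sup>\<times>\<close> is divisible, the group of coboundaries is divisible, so a class killed by \<open>n > 0\<close> has a
  representative killed by \<open>n\<close>. Its values are \<open>n\<close>-th roots of unity, and for \<open>n = N\<^sup>2\<close> only finitely
  many such representatives exist.
\<close>

section \<open>Powers of 2-cocycles on a finite group\<close>

text \<open>Solved for \<open>f (x, y)\<close>, the cocycle identity has a left side free of
  \<open>z\<close>. Its product over all \<open>z\<close> is a power on the left, and on the right
  it splits into three products, each a value of \<open>h\<close> or its inverse. The general group
  setting allows the use on the additive group of a skew brace.\<close>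

lemma (in group) cocycle_pow_order:
  assumes K: "comm_group K" and fin: "finite (carrier G)"
    and cl: "\<And>x y. \<lbrakk>x \<in> carrier G; y \<in> carrier G\<rbrakk> \<Longrightarrow> f (x, y) \<in> carrier K"
    and cocycle: "\<And>x y z. \<lbrakk>x \<in> carrier G; y \<in> carrier G; z \<in> carrier G\<rbrakk> \<Longrightarrow>
      f (y, z) \<otimes>\<^bsub>K\<^esub> inv\<^bsub>K\<^esub> f (x \<otimes> y, z) \<otimes>\<^bsub>K\<^esub> f (x, y \<otimes> z) \<otimes>\<^bsub>K\<^esub> inv\<^bsub>K\<^esub> f (x, y) = \<one>\<^bsub>K\<^esub>"
    and x: "x \<in> carrier G" and y: "y \<in> carrier G"
  defines "h \<equiv> \<lambda>x. finprod K (\<lambda>z. f (x, z)) (carrier G)"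
  shows "f (x, y) [^]\<^bsub>K\<^esub> order G = h y \<otimes>\<^bsub>K\<^esub> inv\<^bsub>K\<^esub> h (x \<otimes> y) \<otimes>\<^bsub>K\<^esub> h x"
proof -
  interpret K: comm_group K by fact
  have h: "h u \<in> carrier K" if "u \<in> carrier G" for u
    unfolding h_def using that by (intro K.finprod_closed) (auto intro: cl)
  have f: "f (x, y) = f (y, z) \<otimes>\<^bsub>K\<^esub> inv\<^bsub>K\<^esub> f (x \<otimes> y, z) \<otimes>\<^bsub>K\<^esub> f (x, y \<otimes> z)" if z: "z \<in> carrier G" for z
    using cocycle[OF x y z] x y z cl by (metis K.inv_closed K.inv_equality K.inv_inv K.m_closed m_closed)
  \<comment> \<open>Left translation by \<open>y\<close> permutes the carrier.\<close>
  have shift: "h x = finprod K (\<lambda>z. f (x, y \<otimes> z)) (carrier G)"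
    using K.finprod_reindex[of "\<lambda>z. f (x, z)" "\<lambda>z. y \<otimes> z" "carrier G"] x y
    by (simp add: h_def surj_const_mult inj_on_cmult cl)
  have inv: "finprod K (\<lambda>z. inv\<^bsub>K\<^esub> f (x \<otimes> y, z)) (carrier G) = inv\<^bsub>K\<^esub> h (x \<otimes> y)"
    unfolding h_def using x y by (intro K.inv_equality[symmetric])
      (auto simp: cl simp flip: K.finprod_multf intro!: K.finprod_one_eqI)
  have "f (x, y) [^]\<^bsub>K\<^esub> order G = finprod K (\<lambda>_. f (x, y)) (carrier G)"
    using x y by (simp add: K.finprod_const cl order_def)
  also have "\<dots> = finprod K (\<lambda>z. f (y, z) \<otimes>\<^bsub>K\<^esub> inv\<^bsub>K\<^esub> f (x \<otimes> y, z) \<otimes>\<^bsub>K\<^esub> f (x, y \<otimes> z)) (carrier G)"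
    using x y by (intro K.finprod_cong' f) (auto simp: cl)
  also have "\<dots> = h y \<otimes>\<^bsub>K\<^esub> inv\<^bsub>K\<^esub> h (x \<otimes> y) \<otimes>\<^bsub>K\<^esub> h x"
    using x y by (simp add: Pi_def cl inv flip: shift) (simp add: h_def)
  finally show ?thesis .
qed

section \<open>Componentwise arithmetic of factor sets\<close>

lemma one_cochain_pairs:
  "\<one>\<^bsub>cochain_pairs Q K\<^esub> =
    (\<lambda>p\<in>carrier Q \<times> carrier Q. \<one>\<^bsub>K\<^esub>, \<lambda>p\<in>carrier Q \<times> carrier Q. \<one>\<^bsub>K\<^esub>)"
  by (simp add: cochain_pairs_def)

lemma carrier_Z2b: "carrier (Z2b Q K) = {(\<alpha>, \<mu>). factor_set Q K \<alpha> \<mu>}"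
  by (simp add: Z2b_def)

lemma one_Z2b: "\<one>\<^bsub>Z2b Q K\<^esub> = \<one>\<^bsub>cochain_pairs Q K\<^esub>"
  by (simp add: Z2b_def)

lemma mult_Z2b: "p \<otimes>\<^bsub>Z2b Q K\<^esub> q = p \<otimes>\<^bsub>cochain_pairs Q K\<^esub> q"
  by (simp add: Z2b_def)

lemma nat_pow_Z2b:
  "(\<alpha>, \<mu>) [^]\<^bsub>Z2b Q K\<^esub> (n::nat) =
    (\<lambda>p\<in>carrier Q \<times> carrier Q. \<alpha> p [^]\<^bsub>K\<^esub> n, \<lambda>p\<in>carrier Q \<times> carrier Q. \<mu> p [^]\<^bsub>K\<^esub> n)"
proof (induction n)
  case 0
  then show ?case by (simp add: one_Z2b one_cochain_pairs restrict_def)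
next
  case (Suc n)
  then show ?case
    by (auto simp: mult_Z2b mult_cochain_pairs intro!: restrict_ext)
qed

lemma factor_set_closed:
  assumes "factor_set Q K \<alpha> \<mu>" "x \<in> carrier Q" "y \<in> carrier Q"
  shows "\<alpha> (x, y) \<in> carrier K" "\<mu> (x, y) \<in> carrier K"
  using assms by (auto simp: factor_set_def)

section \<open>Annihilation by the squared order\<close>

text \<open>Once \<alpha> is trivial, the compatibility condition only says that \<mu> is additive
  in its second argument, so Lagrange's theorem in the additive group applies.\<close>

lemma factor_set_trivial_add:
  assumes Q: "skew_brace Q" and K: "comm_group K"
    and f: "factor_set Q K \<alpha> \<mu>"
    and triv: "\<And>x y. \<lbrakk>x \<in> carrier Q; y \<in> carrier Q\<rbrakk> \<Longrightarrow> \<alpha> (x, y) = \<one>\<^bsub>K\<^esub>"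
    and x: "x \<in> carrier Q" and y: "y \<in> carrier Q"
  shows "\<mu> (x, y) [^]\<^bsub>K\<^esub> order Q = \<one>\<^bsub>K\<^esub>"
proof -
  interpret Q: skew_brace Q by fact
  interpret K: comm_group K by fact
  note cl = factor_set_closed[OF f]
  have "\<mu> (x, u \<oplus>\<^bsub>Q\<^esub> v) = \<mu> (x, u) \<otimes>\<^bsub>K\<^esub> \<mu> (x, v)" if "u \<in> carrier Q" "v \<in> carrier Q" for u v
    using factor_set_eqs(3)[OF f x that] that x by (simp add: triv cl K.m_comm)
  then have hom: "(\<lambda>u. \<mu> (x, u)) \<in> hom (add_monoid Q) K"
    using x by (auto simp: hom_def cl)
  have "\<mu> (x, y) [^]\<^bsub>K\<^esub> order Q = \<mu> (x, y [^]\<^bsub>add_monoid Q\<^esub> order Q)"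
    using hom_nat_pow[OF hom _ Q.add_group K.is_group, of y "order Q"] y by simp
  \<comment> \<open>On an infinite carrier \<open>order Q\<close> is 0 and the equation is
    trivial.\<close>
  also have "y [^]\<^bsub>add_monoid Q\<^esub> order Q = \<zero>\<^bsub>Q\<^esub>"
    using Q.add.pow_order_eq_1[OF y] by (simp add: order_def)
  finally show ?thesis using factor_set_zero[OF f x] by simp
qed

text \<open>The two factors \<open>order Q\<close> act in turn: the first makes the additive
  component a coboundary, the second kills the circle component that remains after dividing by a
  coboundary.\<close>

lemma Z2b_pow_order_square:
  assumes Q: "skew_brace Q" and K: "comm_group K" and fin: "finite (carrier Q)"
    and p: "p \<in> carrier (Z2b Q K)"
  shows "p [^]\<^bsub>Z2b Q K\<^esub> (order Q * order Q) \<in> B2b Q K"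
proof -
  interpret Q: skew_brace Q by fact
  interpret K: comm_group K by fact
  interpret Z: comm_group "Z2b Q K" by (rule comm_group_Z2b[OF Q K])
  note B = subgroup_B2b[OF Q K]
  let ?N = "order Q"
  obtain \<alpha> \<mu> where p_eq: "p = (\<alpha>, \<mu>)" and f: "factor_set Q K \<alpha> \<mu>"
    using p by (auto simp: carrier_Z2b)
  note cl = factor_set_closed[OF f]
  define h where "h = (\<lambda>x. finprod K (\<lambda>z. \<alpha> (x, z)) (carrier Q))"
  have hc: "h x \<in> carrier K" if "x \<in> carrier Q" for x
    unfolding h_def using that by (intro K.finprod_closed) (auto intro: cl)
  \<comment> \<open>The normalisation of \<alpha> at zero carries over to \<open>h\<close>, as
    \<open>B2b\<close> demands.\<close>
  have h0: "h \<zero>\<^bsub>Q\<^esub> = \<one>\<^bsub>K\<^esub>"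
    unfolding h_def by (intro K.finprod_one_eqI) (rule factor_set_zero[OF f])
  have pow: "\<alpha> (x, y) [^]\<^bsub>K\<^esub> ?N = h y \<otimes>\<^bsub>K\<^esub> inv\<^bsub>K\<^esub> h (x \<oplus>\<^bsub>Q\<^esub> y) \<otimes>\<^bsub>K\<^esub> h x"
    if "x \<in> carrier Q" "y \<in> carrier Q" for x y
    using Q.add.cocycle_pow_order[OF K fin, of \<alpha> x y] that factor_set_eqs(1)[OF f]
    by (simp add: cl h_def order_def)
  define b where "b = (coboundary_add Q K h, coboundary_circ Q K h)"
  have b: "b \<in> B2b Q K"
    unfolding b_def B2b_def using hc h0 by auto
  have bZ: "b \<in> carrier (Z2b Q K)"
    using b B by (rule subgroup.mem_carrier[rotated])
  \<comment> \<open>Dividing by \<open>b\<close> leaves the additive component of \<open>q\<close>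
    trivial, since the additive component of \<open>b\<close> is the \<open>?N\<close>-th power of
    \<alpha>.\<close>
  define q where "q = p [^]\<^bsub>Z2b Q K\<^esub> ?N \<otimes>\<^bsub>Z2b Q K\<^esub> inv\<^bsub>Z2b Q K\<^esub> b"
  have qZ: "q \<in> carrier (Z2b Q K)"
    using p bZ by (simp add: q_def)
  obtain \<beta> \<nu> where q_eq: "q = (\<beta>, \<nu>)" and g: "factor_set Q K \<beta> \<nu>"
    using qZ by (auto simp: carrier_Z2b)
  note cl' = factor_set_closed[OF g]
  have qb: "q \<otimes>\<^bsub>Z2b Q K\<^esub> b = p [^]\<^bsub>Z2b Q K\<^esub> ?N"
    using p bZ by (simp add: q_def Z.m_assoc)
  have "\<beta> (x, y) = \<one>\<^bsub>K\<^esub>" if xy: "x \<in> carrier Q" "y \<in> carrier Q" for x y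
  proof -
    have "\<beta> (x, y) \<otimes>\<^bsub>K\<^esub> coboundary_add Q K h (x, y) = \<alpha> (x, y) [^]\<^bsub>K\<^esub> ?N"
      using fun_cong[OF arg_cong[OF qb, of fst], of "(x, y)"] xy
      by (simp add: q_eq b_def p_eq nat_pow_Z2b mult_Z2b mult_cochain_pairs)
    then show ?thesis
      using xy by (simp add: coboundary_add_def pow cl' hc)
  qed
  then have "\<beta> (x, y) [^]\<^bsub>K\<^esub> ?N = \<one>\<^bsub>K\<^esub>" "\<nu> (x, y) [^]\<^bsub>K\<^esub> ?N = \<one>\<^bsub>K\<^esub>"
    if "x \<in> carrier Q" "y \<in> carrier Q" for x y
    using that factor_set_trivial_add[OF Q K g] by simp_all
  then have "q [^]\<^bsub>Z2b Q K\<^esub> ?N = \<one>\<^bsub>Z2b Q K\<^esub>"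
    by (auto simp: q_eq nat_pow_Z2b one_Z2b one_cochain_pairs intro!: restrict_ext)
  \<comment> \<open>In the abelian group \<open>Z2b Q K\<close>, raising \<open>qb\<close> to the
    power \<open>?N\<close> removes \<open>q\<close>.\<close>
  then have "p [^]\<^bsub>Z2b Q K\<^esub> (?N * ?N) = b [^]\<^bsub>Z2b Q K\<^esub> ?N"
    using p qZ bZ by (simp add: Z.nat_pow_distrib flip: Z.nat_pow_pow qb)
  also have "\<dots> \<in> B2b Q K"
    \<comment> \<open>\<open>B2b Q K\<close> is treated as a group in its own right, whose powers
      agree with those in \<open>Z2b Q K\<close>.\<close>
    using Z.subgroup_imp_group[OF B] b monoid.nat_pow_closed[of "Z2b Q K\<lparr>carrier := B2b Q K\<rparr>" b ?N]
    by (simp add: group.is_monoid flip: Z.nat_pow_consistent)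
  finally show ?thesis .
qed

section \<open>Divisibility of the group of coboundaries\<close>

text \<open>Both coboundary maps commute with powers, so it suffices to extract roots of the values
  of \<open>h\<close>.\<close>

lemma B2b_root:
  assumes Q: "skew_brace Q" and K: "comm_group K"
    and div: "\<And>k. k \<in> carrier K \<Longrightarrow> \<exists>r \<in> carrier K. r [^]\<^bsub>K\<^esub> (n::nat) = k"
    and b: "b \<in> B2b Q K"
  shows "\<exists>g \<in> B2b Q K. g [^]\<^bsub>Z2b Q K\<^esub> n = b"
proof -
  interpret Q: skew_brace Q by fact
  interpret K: comm_group K by fact
  obtain h where b_eq: "b = (coboundary_add Q K h, coboundary_circ Q K h)"
    and h: "h \<in> carrier Q \<rightarrow> carrier K" and h0: "h \<zero>\<^bsub>Q\<^esub> = \<one>\<^bsub>K\<^esub>"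
    using b by (auto simp: B2b_def)
  have "\<forall>x\<in>carrier Q. \<exists>r. r \<in> carrier K \<and> r [^]\<^bsub>K\<^esub> n = h x"
    using div h by blast
  then obtain r where r: "\<And>x. x \<in> carrier Q \<Longrightarrow> r x \<in> carrier K \<and> r x [^]\<^bsub>K\<^esub> n = h x"
    by metis
  define s where "s = r(\<zero>\<^bsub>Q\<^esub> := \<one>\<^bsub>K\<^esub>)"
  have s: "s x \<in> carrier K" "s x [^]\<^bsub>K\<^esub> n = h x" if "x \<in> carrier Q" for x
    using r[OF that] h0 by (auto simp: s_def)
  have "(coboundary_add Q K s, coboundary_circ Q K s) \<in> B2b Q K"
    unfolding B2b_def using s by (auto simp: s_def)
  moreover have "(coboundary_add Q K s, coboundary_circ Q K s) [^]\<^bsub>Z2b Q K\<^esub> n = b"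
    by (auto simp: b_eq nat_pow_Z2b coboundary_add_def coboundary_circ_def
        K.nat_pow_distrib K.nat_pow_inv s intro!: restrict_ext)
  ultimately show ?thesis by blast
qed

section \<open>Torsion classes in the cohomology group\<close>

lemma H2b_pow:
  assumes Q: "skew_brace Q" and K: "comm_group K" and p: "p \<in> carrier (Z2b Q K)"
  shows "(B2b Q K #>\<^bsub>Z2b Q K\<^esub> p) [^]\<^bsub>H2b Q K\<^esub> (n::nat) = B2b Q K #>\<^bsub>Z2b Q K\<^esub> (p [^]\<^bsub>Z2b Q K\<^esub> n)"
proof -
  interpret Z: comm_group "Z2b Q K" by (rule comm_group_Z2b[OF Q K])
  interpret H: comm_group "H2b Q K" by (rule comm_group_H2b[OF Q K])
  interpret B: normal "B2b Q K" "Z2b Q K"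
    by (rule Z.subgroup_imp_normal[OF subgroup_B2b[OF Q K]])
  show ?thesis
    using hom_nat_pow[OF B.r_coset_hom_Mod p Z.is_group H.is_group[unfolded H2b_def]]
    by (simp add: H2b_def)
qed

lemma H2b_pow_order_square:
  assumes Q: "skew_brace Q" and K: "comm_group K" and fin: "finite (carrier Q)"
    and c: "c \<in> carrier (H2b Q K)"
  shows "c [^]\<^bsub>H2b Q K\<^esub> (order Q * order Q) = \<one>\<^bsub>H2b Q K\<^esub>"
proof -
  interpret Z: comm_group "Z2b Q K" by (rule comm_group_Z2b[OF Q K])
  obtain p where p: "p \<in> carrier (Z2b Q K)" and c_eq: "c = B2b Q K #>\<^bsub>Z2b Q K\<^esub> p"
    using c by (auto simp: H2b_def FactGroup_def RCOSETS_def)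
  show ?thesis
    using Z2b_pow_order_square[OF Q K fin p] p
    by (simp add: c_eq H2b_pow[OF Q K] Z.coset_join2[OF _ subgroup_B2b[OF Q K]])
      (simp add: H2b_def FactGroup_def)
qed

text \<open>If \<open>p\<close> represents \<open>c\<close>, then its \<open>n\<close>-th power is a
  coboundary, hence the \<open>n\<close>-th power of some coboundary \<open>g\<close>. Dividing
  \<open>p\<close> by \<open>g\<close> keeps the class and makes the \<open>n\<close>-th power
  trivial.\<close>

lemma H2b_torsion_representative:
  assumes Q: "skew_brace Q" and K: "comm_group K"
    and div: "\<And>k. k \<in> carrier K \<Longrightarrow> \<exists>r \<in> carrier K. r [^]\<^bsub>K\<^esub> (n::nat) = k"
    and c: "c \<in> carrier (H2b Q K)" and pow: "c [^]\<^bsub>H2b Q K\<^esub> n = \<one>\<^bsub>H2b Q K\<^esub>"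
  shows "\<exists>\<alpha> \<mu>. factor_set Q K \<alpha> \<mu> \<and> c = B2b Q K #>\<^bsub>Z2b Q K\<^esub> (\<alpha>, \<mu>) \<and>
    (\<forall>x\<in>carrier Q. \<forall>y\<in>carrier Q. \<alpha> (x, y) [^]\<^bsub>K\<^esub> n = \<one>\<^bsub>K\<^esub> \<and> \<mu> (x, y) [^]\<^bsub>K\<^esub> n = \<one>\<^bsub>K\<^esub>)"
proof -
  interpret Z: comm_group "Z2b Q K" by (rule comm_group_Z2b[OF Q K])
  note B = subgroup_B2b[OF Q K]
  obtain p where p: "p \<in> carrier (Z2b Q K)" and c_eq: "c = B2b Q K #>\<^bsub>Z2b Q K\<^esub> p"
    using c by (auto simp: H2b_def FactGroup_def RCOSETS_def)
  \<comment> \<open>The identity of the quotient is \<open>B2b Q K\<close> itself, so triviality of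
    a class becomes membership of its representative.\<close>
  have "B2b Q K #>\<^bsub>Z2b Q K\<^esub> (p [^]\<^bsub>Z2b Q K\<^esub> n) = B2b Q K"
    using pow by (simp add: c_eq H2b_pow[OF Q K p]) (simp add: H2b_def FactGroup_def)
  then have "p [^]\<^bsub>Z2b Q K\<^esub> n \<in> B2b Q K"
    using p by (intro Z.coset_join1[OF _ _ B] Z.nat_pow_closed)
  then obtain g where g: "g \<in> B2b Q K" and gp: "g [^]\<^bsub>Z2b Q K\<^esub> n = p [^]\<^bsub>Z2b Q K\<^esub> n"
    using B2b_root[OF Q K div] by blast
  have gZ: "g \<in> carrier (Z2b Q K)"
    using g B by (rule subgroup.mem_carrier[rotated])
  define q where "q = inv\<^bsub>Z2b Q K\<^esub> g \<otimes>\<^bsub>Z2b Q K\<^esub> p"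
  have qZ: "q \<in> carrier (Z2b Q K)"
    using p gZ by (simp add: q_def)
  obtain \<alpha> \<mu> where q_eq: "q = (\<alpha>, \<mu>)" and f: "factor_set Q K \<alpha> \<mu>"
    using qZ by (auto simp: carrier_Z2b)
  have "q \<in> c"
    unfolding q_def c_eq using p g B by (intro Z.rcosI) (auto simp: subgroup.m_inv_closed subgroup.subset)
  then have c_q: "c = B2b Q K #>\<^bsub>Z2b Q K\<^esub> (\<alpha>, \<mu>)"
    unfolding c_eq q_eq using p B by (intro Z.repr_independence)
  have "q [^]\<^bsub>Z2b Q K\<^esub> n = \<one>\<^bsub>Z2b Q K\<^esub>"
    using p gZ by (simp add: q_def Z.nat_pow_distrib Z.nat_pow_inv gp)
  then have "\<alpha> (x, y) [^]\<^bsub>K\<^esub> n = \<one>\<^bsub>K\<^esub> \<and> \<mu> (x, y) [^]\<^bsub>K\<^esub> n = \<one>\<^bsub>K\<^esub>"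
    if "x \<in> carrier Q" "y \<in> carrier Q" for x y
    using that fun_cong[of _ _ "(x, y)"] by (simp add: q_eq nat_pow_Z2b one_Z2b one_cochain_pairs)
      (metis (mono_tags) SigmaI restrict_apply')
  with f c_q show ?thesis by blast
qed

section \<open>Complex roots and finiteness of the Schur multiplier\<close>

lemma nat_pow_complex_units: "z [^]\<^bsub>complex_units\<^esub> (n::nat) = z ^ n"
  by (induction n) (simp_all add: complex_units_def)

text \<open>A nonzero complex number has exactly \<open>n\<close> roots of degree \<open>n\<close>,
  hence at least one.\<close>

lemma complex_units_divisible:
  assumes "n > 0" "k \<in> carrier complex_units"
  shows "\<exists>r \<in> carrier complex_units. r [^]\<^bsub>complex_units\<^esub> (n::nat) = k"
proof -
  have "k \<noteq> 0" using assms by (simp add: complex_units_def)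
  then have "card {z. z ^ n = k} \<noteq> 0"
    using card_nth_roots[of k n] assms by simp
  then obtain r where "r ^ n = k"
    by fastforce
  with \<open>k \<noteq> 0\<close> \<open>n > 0\<close> show ?thesis
    unfolding nat_pow_complex_units by (intro bexI[of _ r]) (auto simp: complex_units_def)
qed

theorem theorem2p3:
  fixes Q :: "('a, 'b) ring_scheme"
  assumes "skew_brace Q" and "finite (carrier Q)"
  shows "finite (carrier (schur_multiplier Q)) \<and>
    (\<forall>n. \<forall>c \<in> carrier (schur_multiplier Q). group.ord (schur_multiplier Q) c = n \<longrightarrow>
      (\<exists>\<alpha> \<mu>. (\<alpha>, \<mu>) \<in> carrier (Z2b Q complex_units) \<and> (\<alpha>, \<mu>) \<in> c \<and>
        \<alpha> ` (carrier Q \<times> carrier Q) \<subseteq> {z. z ^ n = 1} \<and>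
        \<mu> ` (carrier Q \<times> carrier Q) \<subseteq> {z. z ^ n = 1}))"
proof -
  let ?K = complex_units and ?D = "carrier Q \<times> carrier Q"
  note Q = assms(1) and fin = assms(2) and K = comm_group_complex_units
  interpret Q: skew_brace Q by fact
  interpret Z: comm_group "Z2b Q ?K" by (rule comm_group_Z2b[OF Q K])
  interpret H: comm_group "H2b Q ?K" by (rule comm_group_H2b[OF Q K])
  define N where "N = order Q * order Q"
  have N: "N > 0"
    using fin by (simp add: N_def Q.circ.order_gt_0_iff_finite)
  have pow_N: "c [^]\<^bsub>H2b Q ?K\<^esub> N = \<one>\<^bsub>H2b Q ?K\<^esub>" if "c \<in> carrier (H2b Q ?K)" for c
    using H2b_pow_order_square[OF Q K fin that] by (simp add: N_def)
  have rep: "\<exists>\<alpha> \<mu>. factor_set Q ?K \<alpha> \<mu> \<and> c = B2b Q ?K #>\<^bsub>Z2b Q ?K\<^esub> (\<alpha>, \<mu>) \<and>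
      \<alpha> ` ?D \<subseteq> {z. z ^ n = 1} \<and> \<mu> ` ?D \<subseteq> {z. z ^ n = 1}"
    if "c \<in> carrier (H2b Q ?K)" "c [^]\<^bsub>H2b Q ?K\<^esub> n = \<one>\<^bsub>H2b Q ?K\<^esub>" "n > 0" for c and n :: nat
  proof -
    have one: "\<one>\<^bsub>?K\<^esub> = 1" by (simp add: complex_units_def)
    show ?thesis
      using H2b_torsion_representative[OF Q K complex_units_divisible[OF that(3)] that(1,2)]
      unfolding nat_pow_complex_units one by (simp add: image_subset_iff) blast
  qed
  \<comment> \<open>Factor sets are extensional, so those with values among the \<open>N\<close>-th
    roots of unity lie in this space. As \<open>N > 0\<close>, there are finitely many such roots
    and the space is finite.\<close>
  let ?F = "?D \<rightarrow>\<^sub>E {z::complex. z ^ N = 1}"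
  have "carrier (H2b Q ?K) \<subseteq> (\<lambda>p. B2b Q ?K #>\<^bsub>Z2b Q ?K\<^esub> p) ` (?F \<times> ?F)"
  proof
    fix c assume c: "c \<in> carrier (H2b Q ?K)"
    obtain \<alpha> \<mu> where f: "factor_set Q ?K \<alpha> \<mu>" and c_eq: "c = B2b Q ?K #>\<^bsub>Z2b Q ?K\<^esub> (\<alpha>, \<mu>)"
      and r: "\<alpha> ` ?D \<subseteq> {z. z ^ N = 1}" "\<mu> ` ?D \<subseteq> {z. z ^ N = 1}"
      using rep[OF c pow_N[OF c] N] by blast
    have "(\<alpha>, \<mu>) \<in> ?F \<times> ?F"
      using f r by (auto simp: factor_set_def PiE_iff image_subset_iff)
    then show "c \<in> (\<lambda>p. B2b Q ?K #>\<^bsub>Z2b Q ?K\<^esub> p) ` (?F \<times> ?F)"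
      unfolding c_eq by (rule imageI)
  qed
  moreover have "finite (?F \<times> ?F)"
    using fin N by (intro finite_cartesian_product finite_PiE) auto
  ultimately have "finite (carrier (H2b Q ?K))"
    by (rule finite_surj[rotated])
  moreover have "\<exists>\<alpha> \<mu>. (\<alpha>, \<mu>) \<in> carrier (Z2b Q ?K) \<and> (\<alpha>, \<mu>) \<in> c \<and>
      \<alpha> ` ?D \<subseteq> {z. z ^ H.ord c = 1} \<and> \<mu> ` ?D \<subseteq> {z. z ^ H.ord c = 1}"
    if c: "c \<in> carrier (H2b Q ?K)" for c
  proof -
    \<comment> \<open>\<open>ord\<close> is 0 exactly when no positive power is trivial, which
      \<open>pow_N\<close> excludes. Positivity is what permits extracting roots of degree
      \<open>H.ord c\<close>.\<close>
    have "H.ord c > 0"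
      using pow_N[OF c] N H.ord_eq_0[OF c] by auto
    then obtain \<alpha> \<mu> where f: "factor_set Q ?K \<alpha> \<mu>" and c_eq: "c = B2b Q ?K #>\<^bsub>Z2b Q ?K\<^esub> (\<alpha>, \<mu>)"
      and r: "\<alpha> ` ?D \<subseteq> {z. z ^ H.ord c = 1}" "\<mu> ` ?D \<subseteq> {z. z ^ H.ord c = 1}"
      using rep[OF c H.pow_ord_eq_1[OF c]] by blast
    have "(\<alpha>, \<mu>) \<in> carrier (Z2b Q ?K)"
      using f by (simp add: carrier_Z2b)
    moreover from this have "(\<alpha>, \<mu>) \<in> c"
      unfolding c_eq by (rule Z.rcos_self[OF _ subgroup_B2b[OF Q K]])
    ultimately show ?thesis using r by blast
  qed
  ultimately show ?thesis
    unfolding schur_multiplier_def by blast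
qed

end
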